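(* Let $\mathcal{M},\mathcal{N},\mathcal{S}$ be subspaces of $\mathcal{H}$ satisfying the idempotency condition, and let $E=P_{\mathcal{M},\mathcal{N},\mathcal{S}}$. Then the following are equivalent: (i) $E^*$ is idempotent; (ii) $E^*=P_{\mathcal{N}^{\perp}\cap\mathcal{S}^{\perp},\,\mathcal{M}^{\perp}\cap\mathcal{S}^{\perp},\,\mathcal{M}^{\perp}\cap\mathcal{N}^{\perp}}$; (iii) $(\mathcal{N}^{\perp}+\mathcal{M}^{\perp})\cap\mathcal{S}^{\perp}=(\mathcal{N}^{\perp}\cap\mathcal{S}^{\perp})+(\mathcal{M}^{\perp}\cap\mathcal{S}^{\perp})$.
   Context: $\mathcal{H}$ is a complex separable Hilbert space; "subspace" means linear subspace, not necessarily closed. A linear relation on $\mathcal{H}$ is a linear subspace $T$ of $\mathcal{H}\times\mathcal{H}$; its adjoint is $T^*=\{(x,y)\in\mathcal{H}\times\mathcal{H}:\langle g,x\rangle=\langle f,y\rangle\text{ for all }(f,g)\in T\}$. Product: $ST=\{(x,y): (x,z)\in T,\ (z,y)\in S \text{ for some } z\}$; $T$ is idempotent if $T^2=TT=T$. For subspaces $\mathcal{M},\mathcal{N}$ of $\mathcal{H}$, $P_{\mathcal{M},\mathcal{N}}:=\{(m+n,m): m\in\mathcal{M},\ n\in\mathcal{N}\}$. Subspaces $\mathcal{M},\mathcal{N},\mathcal{S}$ satisfy the idempotency condition if $(\mathcal{M}+\mathcal{N})\cap\mathcal{S}=\mathcal{M}\cap\mathcal{N}$; in that case $P_{\mathcal{M},\mathcal{N},\mathcal{S}}:=P_{\mathcal{M},\mathcal{N}}\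 \hat{+}\ (\{0\}\times\mathcal{S})=\{(m+n,m+s):m\in\mathcal{M},n\in\mathcal{N},s\in\mathcal{S}\}$, where $\hat{+}$ is the sum of subspaces of $\mathcal{H}\times\mathcal{H}$ (the notation with three indices is used only for triplets satisfying the idempotency condition; pairwise intersections of any three subspaces do satisfy it). $\mathcal{M}^\perp$ denotes the orthogonal complement in $\mathcal{H}$. *)

theory Defs
  imports "HOL-Analysis.Analysis" "HOL-Library.Set_Algebras"
begin

section \<open>Complex vector spaces and complex Hilbert spaces\<close>

class complex_vector = real_vector +
  fixes scaleC :: "complex \<Rightarrow> 'a \<Rightarrow> 'a"  (infixr \<open>*\<^sub>C\<close> 75)
  assumes scaleC_add_right: "a *\<^sub>C (x + y) = a *\<^sub>C x + a *\<^sub>C y"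
    and scaleC_add_left: "(a + b) *\<^sub>C x = a *\<^sub>C x + b *\<^sub>C x"
    and scaleC_scaleC: "a *\<^sub>C b *\<^sub>C x = (a * b) *\<^sub>C x"
    and scaleC_one: "1 *\<^sub>C x = x"
    and scaleR_scaleC: "r *\<^sub>R x = complex_of_real r *\<^sub>C x"

global_interpretation complex_vector:
  vector_space "scaleC :: complex \<Rightarrow> 'a \<Rightarrow> 'a::complex_vector"
  defines csubspace = complex_vector.subspace
  by unfold_locales (simp_all add: scaleC_add_right scaleC_add_left scaleC_scaleC scaleC_one)

instantiation prod :: (complex_vector, complex_vector) complex_vector
begin

definition scaleC_prod_def: "a *\<^sub>C p = (a *\<^sub>C fst p, a *\<^sub>C snd p)"

instance
  by standard
    (simp_all add: scaleC_prod_def scaleC_add_right scaleC_add_left scaleC_scaleC scaleC_one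
      scaleR_prod_def scaleR_scaleC)

end

text \<open>The inner product is linear in its first and conjugate-linear in its second argument.
  Since the norm of a normed space is nonnegative and definite, the last axiom makes the
  inner product positive definite as well as fixing the norm it induces.\<close>

class complex_inner = complex_vector + real_normed_vector +
  fixes cinner :: "'a \<Rightarrow> 'a \<Rightarrow> complex"
  assumes cinner_commute: "cinner x y = cnj (cinner y x)"
    and cinner_add_left: "cinner (x + y) z = cinner x z + cinner y z"
    and cinner_scaleC_left: "cinner (a *\<^sub>C x) y = a * cinner x y"
    and cinner_self: "cinner x x = complex_of_real ((norm x)\<^sup>2)"

class chilbert_space = complex_inner + complete_space

instantiation complex :: chilbert_space
begin

definition scaleC_complex_def: "a *\<^sub>C (x::complex) = a * x"
definition cinner_complex_def: "cinner (x::complex) y = x * cnj y"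

instance
proof
  show "cinner x x = complex_of_real ((norm x)\<^sup>2)" for x :: complex
    unfolding cinner_complex_def by (rule complex_norm_square [symmetric])
qed (simp_all add: scaleC_complex_def cinner_complex_def scaleR_conv_of_real ring_distribs)

end

definition ortho :: "'a::complex_inner set \<Rightarrow> 'a set"
  where "ortho M = {x. \<forall>m\<in>M. cinner x m = 0}"

section \<open>Linear relations\<close>

abbreviation linear_relation :: "('a::complex_vector \<times> 'a) set \<Rightarrow> bool"
  where "linear_relation T \<equiv> csubspace T"

definition adj :: "('a::complex_inner \<times> 'a) set \<Rightarrow> ('a \<times> 'a) set"
  where "adj T = {(x, y). \<forall>(f, g)\<in>T. cinner g x = cinner f y}"

text \<open>The product \<open>ST\<close> applies \<open>T\<close> first, hence the arguments of
  \<^const>\<open>relcomp\<close> are swapped.\<close>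

definition rel_prod :: "('a \<times> 'a) set \<Rightarrow> ('a \<times> 'a) set \<Rightarrow> ('a \<times> 'a) set"
  where "rel_prod S T = T O S"

definition idempotent_relation :: "('a::complex_vector \<times> 'a) set \<Rightarrow> bool"
  where "idempotent_relation T \<longleftrightarrow> linear_relation T \<and> rel_prod T T = T"

definition P2 :: "'a::complex_vector set \<Rightarrow> 'a set \<Rightarrow> ('a \<times> 'a) set"
  where "P2 M N = {(m + n, m) | m n. m \<in> M \<and> n \<in> N}"

text \<open>Sums of sets are Minkowski sums, both in the space and in its square.\<close>

definition idempotency_condition :: "'a::complex_vector set \<Rightarrow> 'a set \<Rightarrow> 'a set \<Rightarrow> bool"
  where "idempotency_condition M N S \<longleftrightarrow> (M + N) \<inter> S = M \<inter> N"

text \<open>Only meaningful for subspaces with \<^term>\<open>idempotency_condition M N S\<close>.\<close>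

definition P3 :: "'a::complex_vector set \<Rightarrow> 'a set \<Rightarrow> 'a set \<Rightarrow> ('a \<times> 'a) set"
  where "P3 M N S = P2 M N + ({0} \<times> S)"

end

theory Submission
  imports Defs
begin

text \<open>With \<open>A = M\<^sup>\<bottom>\<close>, \<open>B = N\<^sup>\<bottom>\<close>, \<open>C = S\<^sup>\<bottom>\<close> the adjoint of \<open>E\<close> is the relation of all \<open>(x, y)\<close> with
  \<open>x \<in> C\<close>, \<open>y \<in> B\<close> and \<open>x - y \<in> A\<close>. It is always transitive and always contains
  \<open>P3 (B \<inter> C) (A \<inter> C) (A \<inter> B)\<close>. Both a factorisation of \<open>(x, y)\<close> through an intermediate point \<open>z\<close>
  and a representation \<open>(x, y) = (u + v, u + w)\<close> amount to splitting \<open>x\<close> into the parts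
  \<open>z = u \<in> B \<inter> C\<close> and \<open>x - z = v \<in> A \<inter> C\<close>. Such a splitting exists for all pairs exactly if (iii)
  holds, because the first components of the relation are the elements of \<open>(B + A) \<inter> C\<close>.\<close>

definition diff_relation :: "'a::complex_vector set \<Rightarrow> 'a set \<Rightarrow> 'a set \<Rightarrow> ('a \<times> 'a) set"
  where "diff_relation A B C = {(x, y). x \<in> C \<and> y \<in> B \<and> x - y \<in> A}"

lemma mem_diff_relation [simp]: "(x, y) \<in> diff_relation A B C \<longleftrightarrow> x \<in> C \<and> y \<in> B \<and> x - y \<in> A"
  by (simp add: diff_relation_def)

lemma mem_P3:
  "(x, y) \<in> P3 M N S \<longleftrightarrow> (\<exists>m\<in>M. \<exists>n\<in>N. \<exists>s\<in>S. x = m + n \<and> y = m + s)"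
  by (force simp: P3_def P2_def set_plus_def)

lemma csubspace_diff_relation:
  assumes "csubspace A" "csubspace B" "csubspace C"
  shows "csubspace (diff_relation A B C)"
proof (rule complex_vector.subspaceI)
  show "0 \<in> diff_relation A B C"
    using assms by (simp add: zero_prod_def complex_vector.subspace_0)
next
  fix p q assume "p \<in> diff_relation A B C" "q \<in> diff_relation A B C"
  then show "p + q \<in> diff_relation A B C"
    using assms by (cases p; cases q) (simp add: add_diff_add complex_vector.subspace_add)
next
  fix c p assume "p \<in> diff_relation A B C"
  then show "c *\<^sub>C p \<in> diff_relation A B C"
    using assms
    by (cases p) (simp add: scaleC_prod_def complex_vector.subspace_scale
        flip: complex_vector.scale_right_diff_distrib)
qed

text \<open>For \<open>x = u + v\<close> and \<open>y = u + w\<close>, both summands of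
  \<open>x\<close> lie in \<open>C\<close>, both summands of \<open>y\<close> lie in
  \<open>B\<close>, and the common part cancels: \<open>x - y = v - w\<close> lies in
  \<open>A\<close>.\<close>

lemma P3_subset_diff_relation:
  assumes "csubspace A" "csubspace B" "csubspace C"
  shows "P3 (B \<inter> C) (A \<inter> C) (A \<inter> B) \<subseteq> diff_relation A B C"
  using assms
  by (auto simp: mem_P3 complex_vector.subspace_add complex_vector.subspace_diff)

lemma diff_relation_eq_P3_iff:
  assumes A: "csubspace A" and B: "csubspace B" and C: "csubspace C"
  shows "diff_relation A B C = P3 (B \<inter> C) (A \<inter> C) (A \<inter> B)
    \<longleftrightarrow> (B + A) \<inter> C = (B \<inter> C) + (A \<inter> C)" (is "?T = ?P \<longleftrightarrow> ?iii")
proof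
  assume eq: "?T = ?P"
  have "(B + A) \<inter> C \<subseteq> (B \<inter> C) + (A \<inter> C)"
  proof
    fix x assume "x \<in> (B + A) \<inter> C"
    then obtain b a where "b \<in> B" "a \<in> A" "x = b + a" "x \<in> C"
      by (auto elim: set_plus_elim)
    \<comment> \<open>The summand \<open>b\<close> serves as second component, because
      \<open>x - b = a\<close> lies in \<open>A\<close>.\<close>
    then have "(x, b) \<in> ?P"
      by (simp flip: eq)
    then show "x \<in> (B \<inter> C) + (A \<inter> C)"
      unfolding mem_P3 by blast
  qed
  moreover have "(B \<inter> C) + (A \<inter> C) \<subseteq> (B + A) \<inter> C"
    using C by (auto simp: complex_vector.subspace_add elim!: set_plus_elim)
  ultimately show ?iii by blast
next
  assume iii: ?iii
  have "p \<in> ?P" if "p \<in> ?T" for p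
  proof (cases p)
    case (Pair x y)
    with that have xy: "x \<in> C" "y \<in> B" "x - y \<in> A" by auto
    then have "y + (x - y) \<in> (B + A)" by blast
    with xy iii have "x \<in> (B \<inter> C) + (A \<inter> C)" by auto
    then obtain u v where uv: "u \<in> B \<inter> C" "v \<in> A \<inter> C" "x = u + v"
      by (auto elim: set_plus_elim)
    \<comment> \<open>The left side shows membership in \<open>B\<close>, the right side membership
      in \<open>A\<close>.\<close>
    have "y - u = v - (x - y)" using uv by simp
    moreover have "v - (x - y) \<in> A" "y - u \<in> B"
      using uv xy A B by (blast intro: complex_vector.subspace_diff)+
    ultimately have "y - u \<in> A \<inter> B" by (metis IntI)
    moreover have "y = u + (y - u)" by simp
    ultimately show ?thesis using uv unfolding Pair mem_P3 by blast
  qed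
  moreover have "?P \<subseteq> ?T" by (rule P3_subset_diff_relation [OF assms])
  ultimately show "?T = ?P" by blast
qed

lemma idempotent_diff_relation_iff:
  assumes A: "csubspace A" and B: "csubspace B" and C: "csubspace C"
  shows "idempotent_relation (diff_relation A B C)
    \<longleftrightarrow> diff_relation A B C = P3 (B \<inter> C) (A \<inter> C) (A \<inter> B)" (is "_ ?T \<longleftrightarrow> ?T = ?P")
proof
  assume "idempotent_relation ?T"
  then have idem: "?T O ?T = ?T"
    by (simp add: idempotent_relation_def rel_prod_def)
  have "?T \<subseteq> ?P"
  proof clarify
    fix x y assume "(x, y) \<in> ?T"
    with idem obtain z where "(x, z) \<in> ?T" "(z, y) \<in> ?T" by blast
    \<comment> \<open>The first pair puts \<open>z\<close> in \<open>B\<close>, the second puts it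
      in \<open>C\<close>. Negating \<open>z - y\<close> gives the sign needed for the third
      summand.\<close>
    then have "z \<in> B \<inter> C" "x - z \<in> A \<inter> C" "y - z \<in> A \<inter> B"
      using A B C complex_vector.subspace_neg [OF A, of "z - y"]
      by (simp_all add: complex_vector.subspace_diff)
    moreover have "x = z + (x - z)" "y = z + (y - z)" by simp_all
    ultimately show "(x, y) \<in> ?P" unfolding mem_P3 by blast
  qed
  moreover have "?P \<subseteq> ?T" by (rule P3_subset_diff_relation [OF assms])
  ultimately show "?T = ?P" by blast
next
  assume eq: "?T = ?P"
  have "?T O ?T \<subseteq> ?T"
  proof clarify
    fix x z y assume "(x, z) \<in> ?T" "(z, y) \<in> ?T"
    then show "(x, y) \<in> ?T"
      using complex_vector.subspace_add [OF A, of "x - z" "z - y"] by simp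
  qed
  moreover have "?T \<subseteq> ?T O ?T"
  proof clarify
    fix x y assume xy: "(x, y) \<in> ?T"
    then obtain u v w where "u \<in> B \<inter> C" "v \<in> A \<inter> C" "w \<in> A \<inter> B" "x = u + v" "y = u + w"
      unfolding eq mem_P3 by blast
    \<comment> \<open>The common part \<open>u\<close> is the intermediate point:
      \<open>x - u = v\<close> and \<open>u - y = - w\<close> both lie in \<open>A\<close>.\<close>
    with xy have "(x, u) \<in> ?T" "(u, y) \<in> ?T"
      using A by (simp_all add: complex_vector.subspace_neg)
    then show "(x, y) \<in> ?T O ?T" by blast
  qed
  ultimately show "idempotent_relation ?T"
    using csubspace_diff_relation [OF A B C] by (simp add: idempotent_relation_def rel_prod_def)
qed

lemma cinner_add_right: "cinner x (y + z) = cinner x y + cinner x z"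
  by (metis cinner_add_left cinner_commute complex_cnj_add)

lemma cinner_diff_right: "cinner x (y - z) = cinner x y - cinner x z"
  using cinner_add_right [of x "y - z" z] by simp

lemma cinner_zero_left [simp]: "cinner 0 x = 0"
  using cinner_add_left [of 0 0 x] by simp

lemma cinner_eq_zero_commute: "cinner x y = 0 \<longleftrightarrow> cinner y x = 0"
  by (metis cinner_commute complex_cnj_zero)

lemma csubspace_ortho: "csubspace (ortho M)"
  by (rule complex_vector.subspaceI) (auto simp: ortho_def cinner_add_left cinner_scaleC_left)

text \<open>In a pair \<open>(m + n, m + s)\<close> the three vectors vary independently and each
  may be 0. Hence the one equation defining the adjoint splits into three orthogonality conditions,
  one for each of \<open>M\<close>, \<open>N\<close>, \<open>S\<close>.\<close>

lemma adj_P3: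
  assumes "0 \<in> M" "0 \<in> N" "0 \<in> S"
  shows "adj (P3 M N S) = diff_relation (ortho M) (ortho N) (ortho S)"
proof -
  have "(x, y) \<in> adj (P3 M N S) \<longleftrightarrow> (x, y) \<in> diff_relation (ortho M) (ortho N) (ortho S)" for x y
  proof -
    have "(x, y) \<in> adj (P3 M N S) \<longleftrightarrow>
        (\<forall>m\<in>M. \<forall>n\<in>N. \<forall>s\<in>S. cinner (m + s) x = cinner (m + n) y)"
      by (simp add: adj_def Ball_def split_paired_All mem_P3) blast
    also have "\<dots> \<longleftrightarrow>
        (\<forall>s\<in>S. cinner s x = 0) \<and> (\<forall>n\<in>N. cinner n y = 0) \<and> (\<forall>m\<in>M. cinner m (x - y) = 0)"
      (is "?L \<longleftrightarrow> ?R")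
    proof
      assume L: ?L
      have "cinner s x = 0" if "s \<in> S" for s
        using L [rule_format, OF assms(1,2) that] by simp
      moreover have "cinner n y = 0" if "n \<in> N" for n
        using L [rule_format, OF assms(1) that assms(3)] by simp
      moreover have "cinner m (x - y) = 0" if "m \<in> M" for m
        using L [rule_format, OF that assms(2,3)] by (simp add: cinner_diff_right)
      ultimately show ?R by blast
    next
      assume ?R
      then show ?L by (simp add: cinner_add_left cinner_diff_right)
    qed
    also have "\<dots> \<longleftrightarrow> (x, y) \<in> diff_relation (ortho M) (ortho N) (ortho S)"
      \<comment> \<open>\<open>adj\<close> has \<open>x\<close> and \<open>y\<close> in the second
        argument of \<open>cinner\<close>, \<open>ortho\<close> in the first; for vanishing products
        the order is immaterial.\<close>
      by (simp add: ortho_def cinner_eq_zero_commute [of x] cinner_eq_zero_commute [of y]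
          cinner_eq_zero_commute [of "x - y"])
    finally show ?thesis .
  qed
  then show ?thesis by auto
qed

theorem proposition5p13:
  fixes M N S :: "'a::chilbert_space set" and E :: "('a \<times> 'a) set"
  assumes "separable_space (euclidean :: 'a topology)"
    and "csubspace M" and "csubspace N" and "csubspace S"
    and "idempotency_condition M N S"
    and "E = P3 M N S"
  shows "(idempotent_relation (adj E) \<longleftrightarrow>
            adj E = P3 (ortho N \<inter> ortho S) (ortho M \<inter> ortho S) (ortho M \<inter> ortho N))
       \<and> (adj E = P3 (ortho N \<inter> ortho S) (ortho M \<inter> ortho S) (ortho M \<inter> ortho N) \<longleftrightarrow>
            (ortho N + ortho M) \<inter> ortho S = (ortho N \<inter> ortho S) + (ortho M \<inter> ortho S))"
proof -
  have "adj E = diff_relation (ortho M) (ortho N) (ortho S)"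
    using assms by (simp add: adj_P3 complex_vector.subspace_0)
  then show ?thesis
    using idempotent_diff_relation_iff [OF csubspace_ortho csubspace_ortho csubspace_ortho]
      diff_relation_eq_P3_iff [OF csubspace_ortho csubspace_ortho csubspace_ortho]
    by metis
qed

end
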